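(* Let $R$ be a commutative ring and $N$ a nilpotent ideal of $R$ of nilpotency index $k\geq 2$. Let $s>1$ be the characteristic of the quotient ring $R/N$. If $f\in R$ is such that $f+N$ is an idempotent element of $R/N$, then $$f^{s^{k-1}}$$ is an idempotent element of the ring $R$. Moreover, $|E(R)|=|E(R/N)|$.
   Context: Rings have an identity. For a commutative ring $A$, $E(A)=\{e\in A : e^2=e\}$ denotes its set of idempotent elements, and $|X|$ denotes the cardinality of a set $X$. The nilpotency index of a nilpotent ideal $N$ is the least positive integer $k$ with $N^k=0$, where $N^k$ is the ideal generated by all products of $k$ elements of $N$. *)

theory Defs
  imports "HOL-Algebra.QuotRing" "HOL-Library.Equipollence"
begin

definition idempotents :: "('a, 'b) ring_scheme \<Rightarrow> 'a set" where
  "idempotents R = {e \<in> carrier R. e [^]\<^bsub>R\<^esub> (2::nat) = e}"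

text \<open>Products are taken with \<^const>\<open>finprod\<close>, so this is intended for commutative rings.
  For \<open>n = 0\<close> the only product is the empty one and the power is the whole ring.\<close>

definition ideal_power :: "('a, 'b) ring_scheme \<Rightarrow> 'a set \<Rightarrow> nat \<Rightarrow> 'a set" where
  "ideal_power R N n =
     genideal R {finprod R x {..<n} | x. x \<in> {..<n} \<rightarrow> N}"

definition nilpotent_ideal :: "('a, 'b) ring_scheme \<Rightarrow> 'a set \<Rightarrow> bool" where
  "nilpotent_ideal R N \<longleftrightarrow> ideal N R \<and> (\<exists>n>0. ideal_power R N n = {\<zero>\<^bsub>R\<^esub>})"

text \<open>Only meaningful for nilpotent ideals.\<close>

definition nilpotency_index :: "('a, 'b) ring_scheme \<Rightarrow> 'a set \<Rightarrow> nat" where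
  "nilpotency_index R N = (LEAST n. 0 < n \<and> ideal_power R N n = {\<zero>\<^bsub>R\<^esub>})"

definition ring_characteristic :: "('a, 'b) ring_scheme \<Rightarrow> nat" where
  "ring_characteristic R =
     (if \<exists>n::nat>0. [n] \<cdot>\<^bsub>R\<^esub> \<one>\<^bsub>R\<^esub> = \<zero>\<^bsub>R\<^esub>
      then LEAST n::nat. 0 < n \<and> [n] \<cdot>\<^bsub>R\<^esub> \<one>\<^bsub>R\<^esub> = \<zero>\<^bsub>R\<^esub>
      else 0)"

end

theory Submission
  imports Defs
begin

text \<open>Raising to the power \<open>s\<close> improves congruences: if \<open>a \<equiv> b\<close> modulo \<open>N\<close> then
  \<open>a\<^sup>s - b\<^sup>s = (a - b)(a\<^sup>s\<^sup>-\<^sup>1 + \<dots> + b\<^sup>s\<^sup>-\<^sup>1)\<close>, and the second factor is congruent to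
  \<open>s b\<^sup>s\<^sup>-\<^sup>1\<close>, which lies in \<open>N\<close> because \<open>s\<close> vanishes in \<open>R/N\<close>. Every further \<open>s\<close>-th power
  thus contributes one more factor from \<open>N\<close>, so that the difference of the \<open>s\<^sup>k\<^sup>-\<^sup>1\<close>-th
  powers of \<open>a\<close> and \<open>b\<close> is a product of \<open>k\<close> elements of \<open>N\<close>, hence zero
  (\<open>power_eq_of_diff_in_nilpotent\<close>). In other words, \<open>a \<mapsto> a\<^bsup>s^(k-1)\<^esup>\<close> depends only on the
  coset of \<open>a\<close>.

  Both claims are instances of this. If \<open>f + N\<close> is idempotent, then \<open>f\<^sup>2\<close> and \<open>f\<close> lie in one
  coset, so the power of \<open>f\<close> equals its own square. That power still represents \<open>f + N\<close>, so
  every idempotent of the quotient lifts; and two idempotents of \<open>R\<close> in one coset coincide,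
  because an idempotent equals each of its positive powers. Hence the projection restricts to
  a bijection between the sets of idempotents (\<open>bij_betw_idempotents_quotient\<close>).\<close>

text \<open>This is \<open>a\<^sup>n - b\<^sup>n = (a - b)(\<Sum> a\<^sup>j b\<^sup>n\<^sup>-\<^sup>1\<^sup>-\<^sup>j)\<close> with the sum reduced modulo \<open>N\<close>; isolating
  the error term \<open>c\<close> makes an induction on the exponent possible without finite sums.\<close>

lemma (in cring) diff_power_factorization:
  assumes "ideal N R" "a \<in> carrier R" "b \<in> carrier R" "a \<ominus> b \<in> N"
  shows "\<exists>c\<in>N. a [^] Suc m \<ominus> b [^] Suc m = (a \<ominus> b) \<otimes> (c \<oplus> [Suc m] \<cdot> (b [^] m))"
proof (induction m)
  case 0
  interpret N: ideal N R by fact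
  show ?case
    using assms by (intro bexI[of _ "\<zero>"]) auto
next
  case (Suc m)
  interpret N: ideal N R by fact
  from Suc obtain c where c: "c \<in> N"
    and IH: "a [^] Suc m \<ominus> b [^] Suc m = (a \<ominus> b) \<otimes> (c \<oplus> [Suc m] \<cdot> (b [^] m))" by blast
  define p where "p = b [^] m"
  define q where "q = [Suc m] \<cdot> p"
  define u where "u = a [^] Suc m"
  have [simp]: "c \<in> carrier R" using c by (rule N.a_Hcarr)
  have [simp]: "a \<in> carrier R" "b \<in> carrier R" "p \<in> carrier R" "q \<in> carrier R" "u \<in> carrier R"
    using assms by (auto simp: p_def q_def u_def)
  have qb: "[Suc m] \<cdot> (b [^] Suc m) = q \<otimes> b"
    using assms by (simp add: q_def p_def add_pow_ldistr del: add.nat_pow_Suc)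
  have IH': "u \<ominus> p \<otimes> b = (a \<ominus> b) \<otimes> (c \<oplus> q)"
    using IH by (simp add: u_def p_def q_def)
  have "a [^] Suc (Suc m) \<ominus> b [^] Suc (Suc m) = u \<otimes> a \<ominus> p \<otimes> b \<otimes> b"
    by (simp add: u_def p_def)
  also have "\<dots> = (u \<ominus> p \<otimes> b) \<otimes> a \<oplus> (a \<ominus> b) \<otimes> (p \<otimes> b)"
    by (simp add: minus_eq l_distr r_distr l_minus r_minus a_ac m_ac r_neg2 r_neg1 r_neg)
  \<comment> \<open>Replacing \<open>q a\<close> by \<open>q b\<close> costs \<open>q (a - b)\<close>, which the new error term absorbs.\<close>
  also have "\<dots> = (a \<ominus> b) \<otimes> ((c \<otimes> a \<oplus> q \<otimes> (a \<ominus> b)) \<oplus> (q \<otimes> b \<oplus> p \<otimes> b))"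
    unfolding IH'
    by (simp add: minus_eq l_distr r_distr l_minus r_minus a_ac m_ac r_neg2 r_neg1 r_neg)
  also have "q \<otimes> b \<oplus> p \<otimes> b = [Suc (Suc m)] \<cdot> (b [^] Suc m)"
    using qb by (simp add: p_def)
  finally show ?case
    using c assms by (blast intro: N.a_closed N.I_r_closed N.I_l_closed \<open>q \<in> carrier R\<close>)
qed

lemma (in cring) diff_power_in_ideal_multiple:
  assumes "ideal N R" "a \<in> carrier R" "b \<in> carrier R" "a \<ominus> b \<in> N" "[s] \<cdot> \<one> \<in> N" "0 < (s::nat)"
  shows "\<exists>t\<in>N. a [^] s \<ominus> b [^] s = (a \<ominus> b) \<otimes> t"
proof -
  interpret N: ideal N R by fact
  obtain m where m: "s = Suc m" using \<open>0 < s\<close> by (cases s) auto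
  obtain c where c: "c \<in> N"
    and eq: "a [^] s \<ominus> b [^] s = (a \<ominus> b) \<otimes> (c \<oplus> [s] \<cdot> (b [^] m))"
    using diff_power_factorization[OF assms(1-4)] m by blast
  have "[s] \<cdot> (b [^] m) = ([s] \<cdot> \<one>) \<otimes> b [^] m"
    using assms(3) by (simp add: add_pow_ldistr)
  hence "[s] \<cdot> (b [^] m) \<in> N"
    using assms by (simp add: N.I_r_closed)
  thus ?thesis using eq c by (blast intro: N.a_closed)
qed

text \<open>Exhibiting the difference as one explicit product of elements of \<open>N\<close> places it directly among
  the generators of the ideal power, so no law such as \<open>N\<^sup>i N = N\<^sup>i\<^sup>+\<^sup>1\<close> has to be established.\<close>

lemma (in cring) diff_power_is_product:
  assumes "ideal N R" "a \<in> carrier R" "b \<in> carrier R" "a \<ominus> b \<in> N" "[s] \<cdot> \<one> \<in> N" "0 < (s::nat)"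
  shows "\<exists>x. x \<in> {..<Suc i} \<rightarrow> N \<and> a [^] (s ^ i) \<ominus> b [^] (s ^ i) = finprod R x {..<Suc i}"
proof (induction i)
  case 0
  interpret N: ideal N R by fact
  show ?case
    using assms by (intro exI[of _ "\<lambda>_. a \<ominus> b"]) (auto simp: lessThan_Suc minus_closed)
next
  case (Suc i)
  interpret N: ideal N R by fact
  from Suc obtain x where x: "x \<in> {..<Suc i} \<rightarrow> N"
    and eq: "a [^] (s ^ i) \<ominus> b [^] (s ^ i) = finprod R x {..<Suc i}" by blast
  have xc: "x \<in> {..<Suc i} \<rightarrow> carrier R" using x N.a_Hcarr by blast
  \<comment> \<open>The \<open>s^i\<close>-th powers are again congruent modulo \<open>N\<close>, so the next power supplies a factor \<open>t\<close>.\<close>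
  have "finprod R x {..<Suc i} \<in> N"
  proof -
    have "finprod R x (insert i {..<i}) = x i \<otimes> finprod R x {..<i}"
      using xc by (intro finprod_insert) auto
    moreover have "finprod R x {..<i} \<in> carrier R" using xc by (intro finprod_closed) auto
    ultimately show ?thesis using x by (auto simp: lessThan_Suc intro: N.I_r_closed)
  qed
  then obtain t where t: "t \<in> N"
    and teq: "(a [^] (s ^ i)) [^] s \<ominus> (b [^] (s ^ i)) [^] s
               = (a [^] (s ^ i) \<ominus> b [^] (s ^ i)) \<otimes> t"
    using diff_power_in_ideal_multiple[of N "a [^] (s ^ i)" "b [^] (s ^ i)" s] assms eq by auto
  let ?y = "x(Suc i := t)"
  have "finprod R ?y (insert (Suc i) {..<Suc i}) = ?y (Suc i) \<otimes> finprod R ?y {..<Suc i}"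
    using xc t N.a_Hcarr by (intro finprod_insert) (auto simp: Pi_iff)
  also have "finprod R ?y {..<Suc i} = finprod R x {..<Suc i}"
    using xc by (intro finprod_cong') auto
  finally have "finprod R ?y {..<Suc (Suc i)} = t \<otimes> finprod R x {..<Suc i}"
    by (simp only: lessThan_Suc fun_upd_same)
  also have "\<dots> = finprod R x {..<Suc i} \<otimes> t"
    using t xc by (intro m_comm N.a_Hcarr finprod_closed) auto
  finally have "a [^] (s ^ Suc i) \<ominus> b [^] (s ^ Suc i) = finprod R ?y {..<Suc (Suc i)}"
    using teq eq assms by (simp add: nat_pow_pow mult.commute)
  moreover have "?y \<in> {..<Suc (Suc i)} \<rightarrow> N" using x t by (auto simp: Pi_iff less_Suc_eq)
  ultimately show ?case by blast
qed

lemma (in cring) power_eq_of_diff_in_nilpotent: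
  assumes "ideal N R" "a \<in> carrier R" "b \<in> carrier R" "a \<ominus> b \<in> N" "[s] \<cdot> \<one> \<in> N" "0 < (s::nat)"
    and "ideal_power R N (Suc i) = {\<zero>}"
  shows "a [^] (s ^ i) = b [^] (s ^ i)"
proof -
  interpret N: ideal N R by fact
  let ?P = "{finprod R x {..<Suc i} |x. x \<in> {..<Suc i} \<rightarrow> N}"
  have "?P \<subseteq> carrier R"
    by (auto intro!: finprod_closed simp: Pi_iff)
  hence "?P \<subseteq> ideal_power R N (Suc i)"
    unfolding ideal_power_def by (rule genideal_self)
  moreover have "a [^] (s ^ i) \<ominus> b [^] (s ^ i) \<in> ?P"
    using diff_power_is_product[OF assms(1-6)] by blast
  ultimately have "a [^] (s ^ i) \<ominus> b [^] (s ^ i) = \<zero>"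
    using assms(7) by blast
  thus ?thesis
    using sum_zero_eq_neg[of "a [^] (s ^ i)" "\<ominus> (b [^] (s ^ i))"] assms(2,3)
    by (simp add: minus_eq)
qed

text \<open>Positivity of \<open>s\<close> excludes the value \<open>0\<close> that stands for the absence of a positive annihilator.\<close>

lemma (in ring) quotient_char_in_ideal:
  assumes "ideal N R" "ring_characteristic (R Quot N) = s" "0 < (s::nat)"
  shows "[s] \<cdot> \<one> \<in> N"
proof -
  interpret N: ideal N R by fact
  interpret Q: ring_hom_ring R "R Quot N" "(+>) N" by (rule N.rcos_ring_hom_ring)
  have ex: "\<exists>n::nat>0. [n] \<cdot>\<^bsub>R Quot N\<^esub> \<one>\<^bsub>R Quot N\<^esub> = \<zero>\<^bsub>R Quot N\<^esub>"
    using assms(2,3) unfolding ring_characteristic_def by (auto split: if_splits)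
  hence "[s] \<cdot>\<^bsub>R Quot N\<^esub> \<one>\<^bsub>R Quot N\<^esub> = \<zero>\<^bsub>R Quot N\<^esub>"
    using assms(2) LeastI_ex[OF ex] unfolding ring_characteristic_def by auto
  moreover have "N +> ([n] \<cdot> \<one>) = [n] \<cdot>\<^bsub>R Quot N\<^esub> \<one>\<^bsub>R Quot N\<^esub>" for n :: nat
    by (induction n) auto
  ultimately have "N +> ([s] \<cdot> \<one>) = N +> \<zero>" by (metis Q.hom_zero)
  thus ?thesis
    using quotient_eq_iff_same_a_r_cos[OF assms(1), of "[s] \<cdot> \<one>" \<zero>] by (simp add: minus_eq)
qed

lemma (in ideal) rcos_nat_pow:
  assumes "x \<in> carrier R"
  shows "I +> x [^] n = (I +> x) [^]\<^bsub>R Quot I\<^esub> (n::nat)"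
proof -
  interpret Q: ring_hom_ring R "R Quot I" "(+>) I" by (rule rcos_ring_hom_ring)
  show ?thesis using assms by (induction n) auto
qed

lemma (in monoid) idempotent_pow:
  assumes "e \<in> carrier G" "e [^] (2::nat) = e" "0 < n"
  shows "e [^] (n::nat) = e"
  using assms(3)
proof (induction n rule: nat_induct_non_zero)
  case (Suc n)
  thus ?case using assms(1,2) by (simp add: numeral_2_eq_2)
qed (use assms in simp)

text \<open>The coset of \<open>f\<close> contains both \<open>f\<^sup>2\<close> and \<open>f\<close>, whose \<open>s^i\<close>-th powers therefore agree; and in the
  quotient the idempotent \<open>f + N\<close> is unchanged by taking powers.\<close>

lemma (in cring)
  assumes N: "ideal N R" "[s] \<cdot> \<one> \<in> N" "0 < (s::nat)" "ideal_power R N (Suc i) = {\<zero>}"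
    and f: "f \<in> carrier R" "N +> f \<in> idempotents (R Quot N)"
  shows quotient_idempotent_pow_in_idempotents: "f [^] (s ^ i) \<in> idempotents R"
    and quotient_idempotent_pow_lifts: "N +> f [^] (s ^ i) = N +> f"
proof -
  interpret N: ideal N R by (rule N(1))
  interpret Q: ring_hom_ring R "R Quot N" "(+>) N" by (rule N.rcos_ring_hom_ring)
  have idem: "(N +> f) [^]\<^bsub>R Quot N\<^esub> (2::nat) = N +> f"
    using f(2) by (simp add: idempotents_def)
  hence "N +> f [^] (2::nat) = N +> f"
    using f(1) by (simp add: N.rcos_nat_pow)
  hence "f [^] (2::nat) \<ominus> f \<in> N"
    using quotient_eq_iff_same_a_r_cos[OF N(1), of "f [^] (2::nat)" f] f(1) by simp
  hence "(f [^] (2::nat)) [^] (s ^ i) = f [^] (s ^ i)"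
    using f(1) N by (intro power_eq_of_diff_in_nilpotent) auto
  thus "f [^] (s ^ i) \<in> idempotents R"
    using f(1) by (simp add: idempotents_def nat_pow_pow mult.commute)
  show "N +> f [^] (s ^ i) = N +> f"
    using Q.S.idempotent_pow[OF _ idem, of "s ^ i"] f(1) N(3) by (simp add: N.rcos_nat_pow)
qed

text \<open>Congruent idempotents have equal \<open>s^i\<close>-th powers, and these are the idempotents themselves;
  conversely a coset that is idempotent contains the idempotent power of any representative.\<close>

lemma (in cring) bij_betw_idempotents_quotient:
  assumes N: "ideal N R" "[s] \<cdot> \<one> \<in> N" "0 < (s::nat)" "ideal_power R N (Suc i) = {\<zero>}"
  shows "bij_betw ((+>) N) (idempotents R) (idempotents (R Quot N))"
  unfolding bij_betw_def
proof (intro conjI inj_onI subset_antisym subsetI)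
  fix a b assume "a \<in> idempotents R" "b \<in> idempotents R" and eq: "N +> a = N +> b"
  hence ab: "a \<in> carrier R" "a [^] (2::nat) = a" "b \<in> carrier R" "b [^] (2::nat) = b"
    by (auto simp: idempotents_def)
  have "a \<ominus> b \<in> N"
    using quotient_eq_iff_same_a_r_cos[OF N(1) ab(1,3)] eq by simp
  hence "a [^] (s ^ i) = b [^] (s ^ i)"
    using power_eq_of_diff_in_nilpotent[OF N(1) ab(1,3) _ N(2-4)] by simp
  thus "a = b"
    using idempotent_pow[OF ab(1,2), of "s ^ i"] idempotent_pow[OF ab(3,4), of "s ^ i"] N(3)
    by simp
next
  interpret N: ideal N R by (rule N(1))
  interpret Q: ring_hom_ring R "R Quot N" "(+>) N" by (rule N.rcos_ring_hom_ring)
  fix X assume "X \<in> (+>) N ` idempotents R"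
  then obtain e where e: "X = N +> e" "e \<in> carrier R" "e [^] (2::nat) = e"
    by (auto simp: idempotents_def)
  thus "X \<in> idempotents (R Quot N)"
    using N.rcos_nat_pow[of e 2] by (simp add: idempotents_def)
next
  fix X assume X: "X \<in> idempotents (R Quot N)"
  hence "X \<in> carrier (R Quot N)" by (simp add: idempotents_def)
  then obtain f where f: "f \<in> carrier R" "X = N +> f"
    by (auto simp: FactRing_def A_RCOSETS_def')
  show "X \<in> (+>) N ` idempotents R"
    using quotient_idempotent_pow_in_idempotents[OF N f(1)]
      quotient_idempotent_pow_lifts[OF N f(1)] f(2) X by (metis image_eqI)
qed

theorem proposition4p1:
  fixes R :: "('a, 'b) ring_scheme" and N :: "'a set" and k s :: nat
  assumes "cring R"
    and "nilpotent_ideal R N"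
    and "nilpotency_index R N = k" and "k \<ge> 2"
    and "ring_characteristic (R Quot N) = s" and "s > 1"
  shows "(\<forall>f \<in> carrier R. N +>\<^bsub>R\<^esub> f \<in> idempotents (R Quot N)
            \<longrightarrow> f [^]\<^bsub>R\<^esub> (s ^ (k - 1)) \<in> idempotents R)
         \<and> idempotents R \<approx> idempotents (R Quot N)"
proof -
  interpret cring R by fact
  have N: "ideal N R" using assms(2) unfolding nilpotent_ideal_def by blast
  have "0 < k \<and> ideal_power R N k = {\<zero>\<^bsub>R\<^esub>}"
    using assms(2,3) LeastI_ex[of "\<lambda>n. 0 < n \<and> ideal_power R N n = {\<zero>\<^bsub>R\<^esub>}"]
    unfolding nilpotent_ideal_def nilpotency_index_def by auto
  hence nil: "ideal_power R N (Suc (k - 1)) = {\<zero>\<^bsub>R\<^esub>}" by simp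
  have "0 < s" using assms(6) by simp
  note N_props = N quotient_char_in_ideal[OF N assms(5) this] this nil
  show ?thesis
    using quotient_idempotent_pow_in_idempotents[OF N_props] bij_betw_idempotents_quotient[OF N_props]
    unfolding eqpoll_def by blast
qed

end
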